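(* Let $n\ge 1$. There exist functions $p,q\in\mathcal{P}(\mathbb{R}^n)$ with $\inf_{x\in\mathbb{R}^n}p(x)\ge 1$ and $\inf_{x\in\mathbb{R}^n}q(x)\ge 1$ such that $\|\cdot\,|\,\ell_{q(\cdot)}(L_{p(\cdot)})\|$ does not satisfy the triangle inequality; that is, there are sequences $f=(f_\nu)_{\nu\in\mathbb{N}_0}$ and $g=(g_\nu)_{\nu\in\mathbb{N}_0}$ of functions in $L_{p(\cdot)}(\mathbb{R}^n)$ with $$\|f+g\,|\,\ell_{q(\cdot)}(L_{p(\cdot)})\|>\|f\,|\,\ell_{q(\cdot)}(L_{p(\cdot)})\|+\|g\,|\,\ell_{q(\cdot)}(L_{p(\cdot)})\|.$$
   Context: $\mathcal{P}(\mathbb{R}^n)$ denotes the class of all measurable functions $p:\mathbb{R}^n\to(0,\infty]$ with $\operatorname{ess\,inf}_{x\in\mathbb{R}^n}p(x)>0$. For $t\ge 0$ and $p\in(0,\infty]$ put $\varphi_p(t)=t^p$ if $p\in(0,\infty)$; $\varphi_\infty(t)=0$ if $t\le 1$ and $\varphi_\infty(t)=\infty$ if $t>1$. For $p\in\mathcal{P}(\mathbb{R}^n)$ and a measurable function $f$ on $\mathbb{R}^n$ (functions equal almost everywhere are identified) define the modular $$\varrho_{p(\cdot)}(f)=\int_{\mathbb{R}^n}\varphi_{p(x)}(|f(x)|)\,dx\in[0,\infty].$$ The variable exponent Lebesgue space $L_{p(\cdot)}(\mathbb{R}^n)$ consists of all measurable $f$ for which there is $\lambda>0$ with $\varrho_{p(\cdot)}(f/\lambda)<\infty$.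 For $p,q\in\mathcal{P}(\mathbb{R}^n)$ and a sequence $(f_\nu)_{\nu\in\mathbb{N}_0}$ of functions in $L_{p(\cdot)}(\mathbb{R}^n)$ define $$\varrho_{\ell_{q(\cdot)}(L_{p(\cdot)})}(f_\nu)=\sum_{\nu=0}^\infty\inf\left\{\lambda_\nu>0:\ \varrho_{p(\cdot)}\left(\frac{f_\nu}{\lambda_\nu^{1/q(\cdot)}}\right)\le 1\right\},$$ where $f_\nu/\lambda_\nu^{1/q(\cdot)}$ is the function $x\mapsto f_\nu(x)/\lambda_\nu^{1/q(x)}$, with the convention $\lambda^{1/\infty}:=1$ for $\lambda>0$, and $$\|f_\nu\,|\,\ell_{q(\cdot)}(L_{p(\cdot)})\|=\inf\left\{\mu>0:\ \varrho_{\ell_{q(\cdot)}(L_{p(\cdot)})}(f_\nu/\mu)\le 1\right\}.$$ Convention: $\inf\emptyset=\infty$. Sums of sequences are taken termwise. *)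

theory Defs
  imports "HOL-Analysis.Analysis"
begin

(* Exponents have type ennreal, so that the value infinity is included.  Functions are
   representatives (not classes modulo null sets) with values in a real_normed_field,
   i.e. real- or complex-valued; measurability is with respect to the Lebesgue sigma-algebra. *)

definition essinf :: "'a measure \<Rightarrow> ('a \<Rightarrow> ennreal) \<Rightarrow> ennreal" where
  "essinf M f = Sup {c. AE x in M. c \<le> f x}"

definition exponents :: "('a::euclidean_space \<Rightarrow> ennreal) set" where
  "exponents = {p \<in> borel_measurable lebesgue. (\<forall>x. 0 < p x) \<and> 0 < essinf lebesgue p}"

(* Meant for p > 0 and t \<ge> 0 only. *)
definition phi :: "ennreal \<Rightarrow> real \<Rightarrow> ennreal" where
  "phi p t = (if p = \<infinity> then (if t \<le> 1 then 0 else \<infinity>) else ennreal (t powr enn2real p))"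

definition modular ::
  "('a::euclidean_space \<Rightarrow> ennreal) \<Rightarrow> ('a \<Rightarrow> 'b::real_normed_field) \<Rightarrow> ennreal" where
  "modular p f = (\<integral>\<^sup>+ x. phi (p x) (norm (f x)) \<partial>lebesgue)"

definition Lp_var ::
  "('a::euclidean_space \<Rightarrow> ennreal) \<Rightarrow> ('a \<Rightarrow> 'b::real_normed_field) set" where
  "Lp_var p = {f \<in> borel_measurable lebesgue.
     \<exists>l::real. 0 < l \<and> modular p (\<lambda>x. f x / of_real l) < \<infinity>}"

definition root_exp :: "real \<Rightarrow> ennreal \<Rightarrow> real" where
  "root_exp l q = (if q = \<infinity> then 1 else l powr (1 / enn2real q))"

(* The infima below are taken in ennreal, so that the infimum of the empty set is infinity. *)
definition mixed_modular ::
  "('a::euclidean_space \<Rightarrow> ennreal) \<Rightarrow> ('a \<Rightarrow> ennreal) \<Rightarrow>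
     (nat \<Rightarrow> 'a \<Rightarrow> 'b::real_normed_field) \<Rightarrow> ennreal" where
  "mixed_modular q p f =
     (\<Sum>\<nu>. Inf {ennreal l | l. 0 < l \<and> modular p (\<lambda>x. f \<nu> x / of_real (root_exp l (q x))) \<le> 1})"

definition mixed_norm ::
  "('a::euclidean_space \<Rightarrow> ennreal) \<Rightarrow> ('a \<Rightarrow> ennreal) \<Rightarrow>
     (nat \<Rightarrow> 'a \<Rightarrow> 'b::real_normed_field) \<Rightarrow> ennreal" where
  "mixed_norm q p f =
     Inf {ennreal \<mu> | \<mu>. 0 < \<mu> \<and> mixed_modular q p (\<lambda>\<nu> x. f \<nu> x / of_real \<mu>) \<le> 1}"

end

theory Submission
  imports Defs
begin

text \<open>
  Let \<open>p = 1\<close>, and let \<open>q\<close> be \<open>\<infinity>\<close> on a set \<open>A\<close> and \<open>1\<close> elsewhere, where \<open>A\<close> and \<open>B\<close> are disjoint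
  sets of measure one.  A term \<open>a 1\<^sub>A + b 1\<^sub>B\<close> divided by \<open>\<mu>\<close> contributes the least \<open>\<lambda>\<close> with
  \<open>a / \<mu> + b / (\<mu> \<lambda>) \<le> 1\<close>, that is \<open>b / (\<mu> - a)\<close>, to the modular.  Hence \<open>f = (1\<^sub>B, 0, 0, \<dots>)\<close> and
  \<open>g = (1\<^sub>A, 1\<^sub>B, 0, \<dots>)\<close> have norm one, whereas the norm of \<open>f + g\<close> solves
  \<open>1 / (\<mu> - 1) + 1 / \<mu> = 1\<close>, so it equals \<open>(3 + sqrt 5) / 2 > 5 / 2\<close>.
\<close>

text \<open>The coefficients are real and embedded by \<open>of_real\<close>, so that one example
  serves real and complex values alike.\<close>

definition step :: "'a set \<Rightarrow> 'a set \<Rightarrow> real \<Rightarrow> real \<Rightarrow> 'a \<Rightarrow> 'b::real_normed_field" where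
  "step A B a b x = of_real (a * indicator A x + b * indicator B x)"

definition modular_inf ::
  "('a::euclidean_space \<Rightarrow> ennreal) \<Rightarrow> ('a \<Rightarrow> ennreal) \<Rightarrow> ('a \<Rightarrow> 'b::real_normed_field) \<Rightarrow> ennreal" where
  "modular_inf q p h = Inf {ennreal l | l. 0 < l \<and> modular p (\<lambda>x. h x / of_real (root_exp l (q x))) \<le> 1}"

lemma mixed_modular_eq: "mixed_modular q p f = (\<Sum>\<nu>. modular_inf q p (f \<nu>))"
  by (simp add: mixed_modular_def modular_inf_def)

lemma modular_inf_le:
  assumes "0 < l" "modular p (\<lambda>x. h x / of_real (root_exp l (q x))) \<le> 1"
  shows "modular_inf q p h \<le> ennreal l"
  unfolding modular_inf_def using assms by (intro Inf_lower) auto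

text \<open>The infimum runs over strictly positive \<lambda>, so the value zero is only approached,
  through arbitrarily small \<lambda>.\<close>

lemma modular_inf_eq_0:
  assumes "\<And>l. 0 < l \<Longrightarrow> modular p (\<lambda>x. h x / of_real (root_exp l (q x))) \<le> 1"
  shows "modular_inf q p h = 0"
proof -
  have "modular_inf q p h \<le> 0 + ennreal e" if "0 < e" for e :: real
    using modular_inf_le[OF that assms[OF that]] by simp
  then have "modular_inf q p h \<le> 0"
    by (rule ennreal_le_epsilon)
  then show ?thesis by simp
qed

lemma mixed_norm_le_one:
  assumes "mixed_modular q p f \<le> 1"
  shows "mixed_norm q p f \<le> 1"
  unfolding mixed_norm_def using assms
  by (intro Inf_lower) (auto intro!: exI[of _ 1])

lemma le_essinf_of_le:
  assumes "\<And>x. c \<le> p x"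
  shows "c \<le> essinf M p"
  unfolding essinf_def using assms by (intro Sup_upper) auto

lemma exponents_of_ge_one:
  assumes "p \<in> borel_measurable lebesgue" "\<And>x. 1 \<le> p x"
  shows "p \<in> exponents"
proof -
  have "0 < p x" for x
    using assms(2)[of x] by (metis less_le_trans zero_less_one)
  moreover have "0 < essinf lebesgue p"
    using le_essinf_of_le[of 1 p] assms(2) by (metis less_le_trans zero_less_one)
  ultimately show ?thesis
    using assms(1) by (auto simp: exponents_def)
qed

text \<open>On \<open>A\<close> the exponent is infinite and the root of \<open>l\<close> is 1, so
  \<open>l\<close> has no effect there; on \<open>B\<close>, being disjoint from \<open>A\<close>,
  the exponent is 1 and the root is \<open>l\<close> itself. Unit measures turn the integral into
  the sum of the two heights.\<close>

lemma modular_step: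
  fixes A B :: "'a::euclidean_space set"
  assumes sets: "A \<in> sets lebesgue" "B \<in> sets lebesgue"
    and measure: "emeasure lebesgue A = 1" "emeasure lebesgue B = 1"
    and disj: "A \<inter> B = {}"
    and nonneg: "0 \<le> a" "0 \<le> b" and pos: "0 < \<mu>" "0 < l"
  shows "modular (\<lambda>_. 1) (\<lambda>x. step A B a b x / of_real \<mu> /
      (of_real (root_exp l (if x \<in> A then \<infinity> else 1)) :: 'b::real_normed_field)) =
    ennreal (a / \<mu> + b / (\<mu> * l))"
proof -
  have "phi 1 (norm (step A B a b x / of_real \<mu> /
      (of_real (root_exp l (if x \<in> A then \<infinity> else 1)) :: 'b))) =
    ennreal (a / \<mu>) * indicator A x + ennreal (b / (\<mu> * l)) * indicator B x" for x
    using disj nonneg pos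
    by (auto simp: phi_def step_def root_exp_def norm_divide norm_mult indicator_def)
  then show ?thesis
    using sets measure nonneg pos
    by (simp add: modular_def nn_integral_add nn_integral_cmult)
qed

lemma step_in_Lp_var:
  fixes A B :: "'a::euclidean_space set"
  assumes sets: "A \<in> sets lebesgue" "B \<in> sets lebesgue"
    and measure: "emeasure lebesgue A = 1" "emeasure lebesgue B = 1"
    and disj: "A \<inter> B = {}" and nonneg: "0 \<le> a" "0 \<le> b"
  shows "(step A B a b :: 'a \<Rightarrow> 'b::real_normed_field) \<in> Lp_var (\<lambda>_. 1)"
proof -
  have "(\<lambda>x. a * indicator A x + b * indicator B x :: real) \<in> borel_measurable lebesgue"
    using sets by measurable
  then have "(\<lambda>x. of_real (a * indicator A x + b * indicator B x) :: 'b) \<in> borel_measurable lebesgue"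
    by (rule measurable_compose) (intro borel_measurable_continuous_onI continuous_intros)
  \<comment> \<open>For \<open>l = 1\<close> the root is 1 under either exponent, so the division by
    it disappears.\<close>
  moreover have "modular (\<lambda>_. 1) (\<lambda>x. step A B a b x / of_real 1 :: 'b) < \<infinity>"
    using modular_step[OF assms, of 1 1, where ?'b = 'b]
    by (simp add: root_exp_def if_distrib[of "root_exp _"] cong: if_cong)
  ultimately show ?thesis
    unfolding Lp_var_def step_def[abs_def] by (auto intro!: exI[of _ "1::real"])
qed

lemma triangle_inequality_fails:
  fixes A B :: "'a::euclidean_space set"
  defines "q \<equiv> \<lambda>x. if x \<in> A then \<infinity> else 1"
  defines "f \<equiv> \<lambda>\<nu>::nat. step A B 0 (if \<nu> = 0 then 1 else 0) :: 'a \<Rightarrow> 'b::real_normed_field"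
  defines "g \<equiv> \<lambda>\<nu>::nat. step A B (if \<nu> = 0 then 1 else 0) (if \<nu> = 1 then 1 else 0) :: 'a \<Rightarrow> 'b"
  assumes sets: "A \<in> sets lebesgue" "B \<in> sets lebesgue"
    and measure: "emeasure lebesgue A = 1" "emeasure lebesgue B = 1"
    and disj: "A \<inter> B = {}"
  shows "mixed_norm q (\<lambda>_. 1) f + mixed_norm q (\<lambda>_. 1) g
      < mixed_norm q (\<lambda>_. 1) (\<lambda>\<nu> x. f \<nu> x + g \<nu> x)"
proof -
  have scaled_modular: "modular (\<lambda>_. 1) (\<lambda>x. step A B a b x / of_real \<mu> / (of_real (root_exp l (q x)) :: 'b)) =
      ennreal (a / \<mu> + b / (\<mu> * l))" if "0 \<le> a" "0 \<le> b" "0 < \<mu>" "0 < l" for a b \<mu> l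
    unfolding q_def by (rule modular_step[OF sets measure disj that])
  have modular: "modular (\<lambda>_. 1) (\<lambda>x. step A B a b x / (of_real (root_exp l (q x)) :: 'b)) =
      ennreal (a + b / l)" if "0 \<le> a" "0 \<le> b" "0 < l" for a b l
    using scaled_modular[of a b 1 l] that by simp
  \<comment> \<open>A function carried by \<open>A\<close> has a modular independent of
    \<open>l\<close>, so at height at most 1 every \<open>l\<close> is admissible and the term costs
    nothing.\<close>
  have inf_zero: "modular_inf q (\<lambda>_. 1) (step A B a 0 :: 'a \<Rightarrow> 'b) = 0" if "0 \<le> a" "a \<le> 1" for a
    using that by (intro modular_inf_eq_0) (simp add: modular)
  have inf_one: "modular_inf q (\<lambda>_. 1) (step A B 0 1 :: 'a \<Rightarrow> 'b) \<le> 1"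
    using modular_inf_le[of 1 "\<lambda>_. 1" "step A B 0 1 :: 'a \<Rightarrow> 'b" q] by (simp add: modular)
  have "mixed_modular q (\<lambda>_. 1) f = (\<Sum>\<nu>\<in>{0}. modular_inf q (\<lambda>_. 1) (f \<nu>))"
    unfolding mixed_modular_eq by (rule suminf_finite) (auto simp: f_def inf_zero)
  then have norm_f: "mixed_norm q (\<lambda>_. 1) f \<le> 1"
    using inf_one by (intro mixed_norm_le_one) (simp add: f_def)
  \<comment> \<open>Term 0 of \<open>g\<close> is the indicator of \<open>A\<close>, which is free;
    only the indicator of \<open>B\<close> in term 1 counts.\<close>
  have "mixed_modular q (\<lambda>_. 1) g = (\<Sum>\<nu>\<in>{1}. modular_inf q (\<lambda>_. 1) (g \<nu>))"
    unfolding mixed_modular_eq by (rule suminf_finite) (auto simp: g_def inf_zero)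
  then have norm_g: "mixed_norm q (\<lambda>_. 1) g \<le> 1"
    using inf_one by (intro mixed_norm_le_one) (simp add: g_def)
  \<comment> \<open>Any bound strictly between 2 and (3 + sqrt 5) / 2 would serve; 5/2 keeps the
    arithmetic rational.\<close>
  have "5/2 \<le> \<mu>"
    if "0 < \<mu>" and le: "mixed_modular q (\<lambda>_. 1) (\<lambda>\<nu> x. (f \<nu> x + g \<nu> x) / of_real \<mu>) \<le> 1" for \<mu>
  proof (rule ccontr)
    assume "\<not> 5/2 \<le> \<mu>"
    let ?I = "\<lambda>\<nu>. modular_inf q (\<lambda>_. 1) (\<lambda>x. (f \<nu> x + g \<nu> x) / of_real \<mu>)"
    have sum0: "f 0 x + g 0 x = step A B 1 1 x" and sum1: "f 1 x + g 1 x = step A B 0 1 x" for x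
      by (simp_all add: f_def g_def step_def)
    have "2/3 \<le> l" if "0 < l" "1 / \<mu> + 1 / (\<mu> * l) \<le> 1" for l
    proof -
      \<comment> \<open>Multiplying out, instead of solving for \<open>l\<close>, also covers \<mu>
        \<le> 1, where no \<open>l\<close> is admissible.\<close>
      have "l + 1 \<le> \<mu> * l"
        using that \<open>0 < \<mu>\<close> by (simp add: field_simps)
      also have "\<dots> \<le> 5/2 * l"
        using that \<open>\<not> 5/2 \<le> \<mu>\<close> by (intro mult_right_mono) auto
      finally show ?thesis by simp
    qed
    then have I0: "ennreal (2/3) \<le> ?I 0"
      using \<open>0 < \<mu>\<close> unfolding modular_inf_def sum0
      by (intro Inf_greatest) (auto simp: scaled_modular simp del: divide_divide_eq_left ennreal_plus intro!: ennreal_leI)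
    have "2/5 \<le> l" if "0 < l" "1 / (\<mu> * l) \<le> 1" for l
    proof -
      have "1 \<le> \<mu> * l"
        using that \<open>0 < \<mu>\<close> by (simp add: field_simps)
      also have "\<dots> \<le> 5/2 * l"
        using that \<open>\<not> 5/2 \<le> \<mu>\<close> by (intro mult_right_mono) auto
      finally show ?thesis by simp
    qed
    then have I1: "ennreal (2/5) \<le> ?I 1"
      using \<open>0 < \<mu>\<close> unfolding modular_inf_def sum1
      by (intro Inf_greatest) (auto simp: scaled_modular simp del: divide_divide_eq_left ennreal_plus intro!: ennreal_leI)
    \<comment> \<open>The first two terms alone exceed the budget, since 2/3 + 2/5 = 16/15 >
      1.\<close>
    have "ennreal (2/3) + ennreal (2/5) \<le> (\<Sum>\<nu>\<in>{0, 1}. ?I \<nu>)"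
      using add_mono[OF I0 I1] by simp
    also have "\<dots> \<le> (\<Sum>\<nu>. ?I \<nu>)"
      by (intro sum_le_suminf) auto
    also have "\<dots> \<le> ennreal 1"
      using le by (simp add: mixed_modular_eq)
    finally show False
      by (simp flip: ennreal_plus)
  qed
  then have "ennreal (5/2) \<le> mixed_norm q (\<lambda>_. 1) (\<lambda>\<nu> x. f \<nu> x + g \<nu> x)"
    unfolding mixed_norm_def by (intro Inf_greatest) (auto intro!: ennreal_leI)
  moreover have "mixed_norm q (\<lambda>_. 1) f + mixed_norm q (\<lambda>_. 1) g \<le> ennreal 2"
    using add_mono[OF norm_f norm_g] by simp
  moreover have "ennreal 2 < ennreal (5/2)"
    by (simp add: ennreal_less_iff del: ennreal_numeral)
  ultimately show ?thesis
    by (meson le_less_trans less_le_trans)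
qed

lemma disjoint_unit_cubes:
  obtains A B :: "'a::euclidean_space set"
  where "A \<in> sets lebesgue" "B \<in> sets lebesgue"
    "emeasure lebesgue A = 1" "emeasure lebesgue B = 1" "A \<inter> B = {}"
proof
  let ?A = "box 0 One :: 'a set" and ?B = "box One (2 *\<^sub>R One) :: 'a set"
  show "?A \<in> sets lebesgue" "?B \<in> sets lebesgue" by auto
  show "emeasure lebesgue ?A = 1" "emeasure lebesgue ?B = 1"
    by (auto simp: emeasure_lborel_box inner_diff_left)
  \<comment> \<open>One coordinate separates the cubes: it lies below 1 on \<open>?A\<close> and
    above 1 on \<open>?B\<close>.\<close>
  obtain i :: 'a where "i \<in> Basis" using nonempty_Basis by blast
  then show "?A \<inter> ?B = {}" by (force simp: mem_box)
qed

theorem theorem2: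
  shows "\<exists>p q :: real ^ 'n \<Rightarrow> ennreal.
    p \<in> exponents \<and> q \<in> exponents \<and> (INF x. p x) \<ge> 1 \<and> (INF x. q x) \<ge> 1 \<and>
    (\<exists>f g :: nat \<Rightarrow> real ^ 'n \<Rightarrow> 'b::real_normed_field.
       (\<forall>\<nu>. f \<nu> \<in> Lp_var p) \<and> (\<forall>\<nu>. g \<nu> \<in> Lp_var p) \<and>
       mixed_norm q p (\<lambda>\<nu> x. f \<nu> x + g \<nu> x) > mixed_norm q p f + mixed_norm q p g)"
proof -
  obtain A B :: "(real ^ 'n) set"
    where AB: "A \<in> sets lebesgue" "B \<in> sets lebesgue"
      "emeasure lebesgue A = 1" "emeasure lebesgue B = 1" "A \<inter> B = {}"
    by (rule disjoint_unit_cubes)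
  let ?q = "\<lambda>x. if x \<in> A then \<infinity> else 1 :: ennreal"
  have "?q \<in> borel_measurable lebesgue"
    using AB(1) by (intro measurable_If_set) auto
  then have "?q \<in> exponents"
    by (rule exponents_of_ge_one) auto
  moreover have "(\<lambda>_. 1 :: ennreal) \<in> (exponents :: (real ^ 'n \<Rightarrow> ennreal) set)"
    by (rule exponents_of_ge_one) auto
  moreover have "1 \<le> (INF x. ?q x)"
    by (rule INF_greatest) auto
  ultimately show ?thesis
    using triangle_inequality_fails[OF AB, where ?'b = 'b]
      step_in_Lp_var[OF AB, where ?'b = 'b]
    by (intro exI[of _ "\<lambda>_. 1"] exI[of _ ?q] conjI exI) auto
qed

end
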